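(* Let $g$ be an admissible window function, with constant $b_0\in(0,1)$ and functions $\beta,\gamma$ as in condition (c) of the definition of admissibility. Let $x\in\mathcal{E}_{\varepsilon_1,\varepsilon_3}$ for some $\varepsilon_1,\varepsilon_3>0$. Let $\rho>0$ and $\triangle>0$ be such that $$|\phi_k'(t)-\phi_\ell'(t)|+\rho\,|\phi_k''(t)-\phi_\ell''(t)|\ge 2\triangle\qquad\text{for all } t\in\mathbb{R},\ 0\le k,\ell\le K,\ k\ne\ell .$$ Fix $t\in\mathbb{R}$ and suppose that $$2M(t)\big(\Upsilon(t)+\Pi(t)\big)\le \mu(t)\qquad\text{and}\qquad \frac{2\,\mathrm{Res}_\ell(t)}{A_\ell(t)}\le b_0\quad\text{for } 0\le\ell\le K .$$ Let $\widetilde\epsilon_1=\widetilde\epsilon_1(t)>0$ satisfy $$M(t)\big(\Upsilon(t)+\Pi(t)\big)\le\widetilde\epsilon_1\le\mu(t)-M(t)\big(\Upsilon(t)+\Pi(t)\big),$$ and let $$\mathcal{G}_t=\{(\eta,\lambda)\in\mathbb{R}^2:\ |\mathcal{Q}_x(t,\eta,\lambda)|>\widetilde\epsilon_1\},$$ $$\mathcal{G}_{t,k}=\{(\eta,\lambda)\in\mathcal{G}_t:\ |\eta-\phi_k'(t)|+\rho\,|\lambda-\phi_k''(t)|<\triangle\},\quad 0\le k\le K .$$ Set $\widehat\eta_0=\widehat\lambda_0=0$ and, for $1\le k\le K$, $(\widehat\eta_k,\widehat\lambda_k)=(\widehat\eta_k(t),\widehat\lambda_k(t))=\mathrm{argmax}_{(\eta,\lambda)\in\mathcal{G}_{t,k}}|\mathcal{Q}_x(t,\eta,\lambda)|$.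 Then: (a) for $\ell=1,2,\dots,K$, $$|\widehat\eta_\ell(t)-\phi_\ell'(t)|\le\frac1{\sigma(t)}\,\beta^{-1}\Big(1-\frac{2\,\mathrm{Res}_\ell(t)}{A_\ell(t)}\Big),\qquad |\widehat\lambda_\ell(t)-\phi_\ell''(t)|\le\frac1{\sigma^2(t)}\,\gamma^{-1}\Big(1-\frac{2\,\mathrm{Res}_\ell(t)}{A_\ell(t)}\Big);$$ (b) for $\ell=0,1,\dots,K$, $$\big|\mathcal{Q}_x(t,\widehat\eta_\ell,\widehat\lambda_\ell)-x_\ell(t)\big|\le \mathrm{Res}_\ell(t)+2\pi I_1A_\ell(t)\,\beta^{-1}\Big(1-\frac{2\,\mathrm{Res}_\ell(t)}{A_\ell(t)}\Big)+\pi I_2A_\ell(t)\,\gamma^{-1}\Big(1-\frac{2\,\mathrm{Res}_\ell(t)}{A_\ell(t)}\Big);$$ (c) if, in addition, $g(s)\ge0$ for all $s\in\mathbb{R}$, then for $\ell=0,1,\dots,K$, $$\big|\,|\mathcal{Q}_x(t,\widehat\eta_\ell,\widehat\lambda_\ell)|-A_\ell(t)\big|\le\mathrm{Res}_\ell(t).$$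
   Context: **Signals.** Let $K\ge1$ be an integer and $\varepsilon_1,\varepsilon_3>0$. $\mathcal{E}_{\varepsilon_1,\varepsilon_3}$ is the set of signals $x(t)=\sum_{k=0}^K x_k(t)$, $x_k(t)=A_k(t)e^{i2\pi\phi_k(t)}$, $t\in\mathbb{R}$, where $\phi_0\equiv0$ (so $x_0=A_0$ is the trend), and: - for $0\le k\le K$: $A_k\in L_\infty(\mathbb{R})$, $A_k(t)>0$, and $|A_k(t+\tau)-A_k(t)|\le\varepsilon_1|\tau|A_k(t)$ for all $t,\tau\in\mathbb{R}$; - for $1\le k\le K$: $\phi_k\in C^3(\mathbb{R})$ is real-valued, $\inf_{t}\phi_k'(t)>0$, $\sup_t\phi_k'(t)<\infty$, and $|\phi_k'''(t)|\le\varepsilon_3$ for all $t\in\mathbb{R}$. Put $\mu(t)=\min_{0\le k\le K}A_k(t)$ and $M(t)=\sum_{k=0}^K A_k(t)$. **Window and transform.** A window function $g$ is a continuous function in $L_1(\mathbb{R})\cap L_2(\mathbb{R})$ with $\int_{\mathbb{R}}g(t)\,dt=1$ (with decay at infinity such that the moments $I_n$ used below make sense), and $\sigma(t)>0$ is a positive function on $\mathbb{R}$; write $\sigma=\sigma(t)$. The adaptive chirplet transform of $x$ with window $g$ is $$\mathcal{Q}_x(t,\eta,\lambda)=\int_{\mathbb{R}}x(t+\tau)\,\frac1{\sigma(t)}g\Big(\frac{\tau}{\sigma(t)}\Big)e^{-i2\pi\eta\tau-i\pi\lambda\tau^2}\,d\tau .$$ Also let $$\breve g(\eta,\lambda)=\int_{\mathbb{R}}g(\tau)e^{-i2\pi\eta\tau-i\pi\lambda\tau^2}\,d\tau,\qquad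 I_n=\int_{\mathbb{R}}|g(t)t^n|\,dt,$$ $$\Pi(t)=\varepsilon_1I_1\sigma(t)+\frac{\pi}{3}\varepsilon_3I_3\sigma^3(t).$$ **Admissible window functions.** A window function $g$ is admissible if: (a) there is a constant $C$ with $|\breve g(\eta,\lambda)|\le C/\sqrt{|\eta|+|\lambda|}$ for all $\eta,\lambda\in\mathbb{R}$; (b) $|\breve g(\eta,\lambda)|=f(|\eta|,|\lambda|)$ for some function $f(\xi_1,\xi_2)$ defined for $0\le\xi_1,\xi_2<\infty$; (c) there exist $b_0$ with $0<b_0<1$ and strictly decreasing non-negative continuous functions $\beta,\gamma$ on $[0,\infty)$ with $\beta(0)=\gamma(0)=1$ such that, for all $b\in[0,b_0]$ and all $\eta,\lambda\ge0$, if $1-b\le f(\eta,\lambda)$ then $1-b\le\beta(\eta)$ and $1-b\le\gamma(\lambda)$. $\beta^{-1},\gamma^{-1}$ denote the inverse functions; for an argument $s\le 1$ below the range of $\beta$ (resp. $\gamma$), the value is understood as $+\infty$, i.e. $\beta^{-1}(s)=\sup\{\xi\ge0:\beta(\xi)\ge s\}$, and likewise for $\gamma^{-1}$. **Bounding functions.** For the given $\rho,\triangle>0$, let $Z_k=\{(t,\eta,\lambda)\in\mathbb{R}^3:\ |\eta-\phi_k'(t)|+\rho|\lambda-\phi_k''(t)|<\triangle\}$, $0\le k\le K$. $\Upsilon(t)$ and $\Upsilon_{\ell,k}(t)$ ($0\le\ell,k\le K$, $k\ne\ell$) are any functions with $\Upsilon(t)\ge\Upsilon_{\ell,k}(t)$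 for all $k\neq\ell$ such that, for every $t$, $$\big|\breve g\big(\sigma(\eta-\phi_k'(t)),\sigma^2(\lambda-\phi_k''(t))\big)\big|\le\Upsilon(t)\quad\text{for all }0\le k\le K\text{ and all }(\eta,\lambda)\text{ with }(t,\eta,\lambda)\notin\textstyle\bigcup_{j=0}^KZ_j,$$ $$\big|\breve g\big(\sigma(\eta-\phi_k'(t)),\sigma^2(\lambda-\phi_k''(t))\big)\big|\le\Upsilon_{\ell,k}(t)\quad\text{for all }k\ne\ell\text{ and all }(\eta,\lambda)\text{ with }(t,\eta,\lambda)\in Z_\ell .$$ Finally, $$\mathrm{Res}_\ell(t)=M(t)\Pi(t)+\sum_{0\le k\le K,\ k\ne\ell}A_k(t)\Upsilon_{\ell,k}(t).$$ If the argmax is not unique, $(\widehat\eta_k,\widehat\lambda_k)$ denotes any maximizer. *)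

theory Defs
  imports "HOL-Analysis.Analysis"
begin

definition C_k :: "nat \<Rightarrow> (real \<Rightarrow> real) \<Rightarrow> bool" where
  "C_k n f \<longleftrightarrow> (\<forall>m<n. \<forall>t. (deriv ^^ m) f differentiable (at t)) \<and>
     continuous_on UNIV ((deriv ^^ n) f)"

definition L_infinity :: "(real \<Rightarrow> real) \<Rightarrow> bool" where
  "L_infinity f \<longleftrightarrow> f \<in> borel_measurable lebesgue \<and> (\<exists>C. AE t in lebesgue. \<bar>f t\<bar> \<le> C)"

subsection \<open>Signals\<close>

definition component :: "(nat \<Rightarrow> real \<Rightarrow> real) \<Rightarrow> (nat \<Rightarrow> real \<Rightarrow> real) \<Rightarrow> nat \<Rightarrow> real \<Rightarrow> complex" where
  "component A \<phi> k t = of_real (A k t) * exp (\<i> * of_real (2 * pi * \<phi> k t))"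

text \<open>
  A signal \<open>x\<close> belongs to the class with parameters \<open>K\<close>, \<open>\<epsilon>1\<close>, \<open>\<epsilon>3\<close> iff
  \<open>signal_decomposition K \<epsilon>1 \<epsilon>3 A \<phi> x\<close> holds for some \<open>A\<close> and \<open>\<phi>\<close>. The amplitudes and phases
  are kept as parameters because the estimates below refer to them. The infimum and the supremum
  of the first derivative are taken in the extended reals, where they always exist.
\<close>

definition signal_decomposition ::
    "nat \<Rightarrow> real \<Rightarrow> real \<Rightarrow> (nat \<Rightarrow> real \<Rightarrow> real) \<Rightarrow> (nat \<Rightarrow> real \<Rightarrow> real) \<Rightarrow> (real \<Rightarrow> complex) \<Rightarrow> bool" where
  "signal_decomposition K \<epsilon>1 \<epsilon>3 A \<phi> x \<longleftrightarrow>
     (\<forall>t. x t = (\<Sum>k\<le>K. component A \<phi> k t)) \<and>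
     (\<forall>t. \<phi> 0 t = 0) \<and>
     (\<forall>k\<le>K. L_infinity (A k) \<and> (\<forall>t. 0 < A k t) \<and>
        (\<forall>t \<tau>. \<bar>A k (t + \<tau>) - A k t\<bar> \<le> \<epsilon>1 * \<bar>\<tau>\<bar> * A k t)) \<and>
     (\<forall>k\<in>{1..K}. C_k 3 (\<phi> k) \<and>
        0 < (INF t. ereal (deriv (\<phi> k) t)) \<and>
        (SUP t. ereal (deriv (\<phi> k) t)) < \<infinity> \<and>
        (\<forall>t. \<bar>(deriv ^^ 3) (\<phi> k) t\<bar> \<le> \<epsilon>3))"

definition amp_min :: "nat \<Rightarrow> (nat \<Rightarrow> real \<Rightarrow> real) \<Rightarrow> real \<Rightarrow> real" where
  "amp_min K A t = Min ((\<lambda>k. A k t) ` {..K})"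

definition amp_sum :: "nat \<Rightarrow> (nat \<Rightarrow> real \<Rightarrow> real) \<Rightarrow> real \<Rightarrow> real" where
  "amp_sum K A t = (\<Sum>k\<le>K. A k t)"

subsection \<open>Windows and transforms\<close>

definition window :: "(real \<Rightarrow> complex) \<Rightarrow> bool" where
  "window g \<longleftrightarrow> continuous_on UNIV g \<and>
     integrable lborel g \<and> integrable lborel (\<lambda>t. (cmod (g t))\<^sup>2) \<and>
     (LBINT t. g t) = 1 \<and>
     (\<forall>n\<in>{1, 2, 3}. integrable lborel (\<lambda>t. g t * of_real (t ^ n)))"

definition moment :: "(real \<Rightarrow> complex) \<Rightarrow> nat \<Rightarrow> real" where
  "moment g n = (LBINT t. cmod (g t * of_real (t ^ n)))"

definition chirplet_kernel :: "real \<Rightarrow> real \<Rightarrow> real \<Rightarrow> complex" where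
  "chirplet_kernel \<eta> \<kappa> \<tau> =
     exp (- (\<i> * of_real (2 * pi * \<eta> * \<tau>)) - \<i> * of_real (pi * \<kappa> * \<tau>\<^sup>2))"

definition chirplet_transform ::
    "(real \<Rightarrow> complex) \<Rightarrow> (real \<Rightarrow> real) \<Rightarrow> (real \<Rightarrow> complex) \<Rightarrow> real \<Rightarrow> real \<Rightarrow> real \<Rightarrow> complex" where
  "chirplet_transform g \<sigma> x t \<eta> \<kappa> =
     (LBINT \<tau>. x (t + \<tau>) * of_real (1 / \<sigma> t) * g (\<tau> / \<sigma> t) * chirplet_kernel \<eta> \<kappa> \<tau>)"

definition window_breve :: "(real \<Rightarrow> complex) \<Rightarrow> real \<Rightarrow> real \<Rightarrow> complex" where
  "window_breve g \<eta> \<kappa> = (LBINT \<tau>. g \<tau> * chirplet_kernel \<eta> \<kappa> \<tau>)"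

definition model_error :: "(real \<Rightarrow> complex) \<Rightarrow> (real \<Rightarrow> real) \<Rightarrow> real \<Rightarrow> real \<Rightarrow> real \<Rightarrow> real" where
  "model_error g \<sigma> \<epsilon>1 \<epsilon>3 t =
     \<epsilon>1 * moment g 1 * \<sigma> t + pi / 3 * \<epsilon>3 * moment g 3 * (\<sigma> t) ^ 3"

text \<open>
  The witnesses \<open>b0\<close>, \<open>\<beta>\<close>, \<open>\<gamma>\<close> are parameters of admissibility since the estimates refer to them.
  The decay bound has to exclude the origin: there its right-hand side is infinite on paper,
  but \<open>C / 0 = 0\<close> in HOL.
\<close>

definition admissible_window ::
    "(real \<Rightarrow> complex) \<Rightarrow> real \<Rightarrow> (real \<Rightarrow> real) \<Rightarrow> (real \<Rightarrow> real) \<Rightarrow> bool" where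
  "admissible_window g b0 \<beta> \<gamma> \<longleftrightarrow> window g \<and>
     (\<exists>C. \<forall>\<eta> \<kappa>. (\<eta>, \<kappa>) \<noteq> (0, 0) \<longrightarrow> cmod (window_breve g \<eta> \<kappa>) \<le> C / sqrt (\<bar>\<eta>\<bar> + \<bar>\<kappa>\<bar>)) \<and>
     0 < b0 \<and> b0 < 1 \<and>
     strict_antimono_on {0..} \<beta> \<and> (\<forall>\<xi>\<ge>0. 0 \<le> \<beta> \<xi>) \<and> continuous_on {0..} \<beta> \<and> \<beta> 0 = 1 \<and>
     strict_antimono_on {0..} \<gamma> \<and> (\<forall>\<xi>\<ge>0. 0 \<le> \<gamma> \<xi>) \<and> continuous_on {0..} \<gamma> \<and> \<gamma> 0 = 1 \<and>
     (\<exists>f. (\<forall>\<eta> \<kappa>. cmod (window_breve g \<eta> \<kappa>) = f \<bar>\<eta>\<bar> \<bar>\<kappa>\<bar>) \<and>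
        (\<forall>b\<in>{0..b0}. \<forall>\<eta>\<ge>0. \<forall>\<kappa>\<ge>0.
           1 - b \<le> f \<eta> \<kappa> \<longrightarrow> 1 - b \<le> \<beta> \<eta> \<and> 1 - b \<le> \<gamma> \<kappa>))"

text \<open>
  For \<open>s \<le> 1\<close> and a strictly decreasing continuous \<open>\<beta>\<close> on \<open>[0, \<infinity>)\<close> with \<open>\<beta> 0 = 1\<close>, this is the
  inverse of \<open>\<beta>\<close> at \<open>s\<close> if \<open>s\<close> is in the range of \<open>\<beta>\<close>, and \<open>\<infinity>\<close> otherwise.
\<close>

definition decreasing_inverse :: "(real \<Rightarrow> real) \<Rightarrow> real \<Rightarrow> ereal" where
  "decreasing_inverse \<beta> s = (SUP \<xi>\<in>{\<xi>. 0 \<le> \<xi> \<and> s \<le> \<beta> \<xi>}. ereal \<xi>)"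

subsection \<open>Time-frequency-chirprate zones\<close>

definition zone :: "(nat \<Rightarrow> real \<Rightarrow> real) \<Rightarrow> real \<Rightarrow> real \<Rightarrow> nat \<Rightarrow> (real \<times> real \<times> real) set" where
  "zone \<phi> \<rho> \<Delta> k = {(t, \<eta>, \<kappa>).
     \<bar>\<eta> - deriv (\<phi> k) t\<bar> + \<rho> * \<bar>\<kappa> - (deriv ^^ 2) (\<phi> k) t\<bar> < \<Delta>}"

definition bounding_functions ::
    "nat \<Rightarrow> (nat \<Rightarrow> real \<Rightarrow> real) \<Rightarrow> (real \<Rightarrow> complex) \<Rightarrow> (real \<Rightarrow> real) \<Rightarrow> real \<Rightarrow> real \<Rightarrow>
     (real \<Rightarrow> real) \<Rightarrow> (nat \<Rightarrow> nat \<Rightarrow> real \<Rightarrow> real) \<Rightarrow> bool" where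
  "bounding_functions K \<phi> g \<sigma> \<rho> \<Delta> \<Upsilon> \<Upsilon>' \<longleftrightarrow>
     (\<forall>t. \<forall>l\<le>K. \<forall>k\<le>K. k \<noteq> l \<longrightarrow> \<Upsilon>' l k t \<le> \<Upsilon> t) \<and>
     (\<forall>t. \<forall>k\<le>K. \<forall>\<eta> \<kappa>. (t, \<eta>, \<kappa>) \<notin> (\<Union>j\<le>K. zone \<phi> \<rho> \<Delta> j) \<longrightarrow>
        cmod (window_breve g (\<sigma> t * (\<eta> - deriv (\<phi> k) t))
          ((\<sigma> t)\<^sup>2 * (\<kappa> - (deriv ^^ 2) (\<phi> k) t))) \<le> \<Upsilon> t) \<and>
     (\<forall>t. \<forall>l\<le>K. \<forall>k\<le>K. \<forall>\<eta> \<kappa>. k \<noteq> l \<longrightarrow> (t, \<eta>, \<kappa>) \<in> zone \<phi> \<rho> \<Delta> l \<longrightarrow>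
        cmod (window_breve g (\<sigma> t * (\<eta> - deriv (\<phi> k) t))
          ((\<sigma> t)\<^sup>2 * (\<kappa> - (deriv ^^ 2) (\<phi> k) t))) \<le> \<Upsilon>' l k t)"

definition Res ::
    "nat \<Rightarrow> (nat \<Rightarrow> real \<Rightarrow> real) \<Rightarrow> (real \<Rightarrow> complex) \<Rightarrow> (real \<Rightarrow> real) \<Rightarrow> real \<Rightarrow> real \<Rightarrow>
     (nat \<Rightarrow> nat \<Rightarrow> real \<Rightarrow> real) \<Rightarrow> nat \<Rightarrow> real \<Rightarrow> real" where
  "Res K A g \<sigma> \<epsilon>1 \<epsilon>3 \<Upsilon>' l t =
     amp_sum K A t * model_error g \<sigma> \<epsilon>1 \<epsilon>3 t + (\<Sum>k\<in>{..K} - {l}. A k t * \<Upsilon>' l k t)"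

definition superlevel_set ::
    "(real \<Rightarrow> complex) \<Rightarrow> (real \<Rightarrow> real) \<Rightarrow> (real \<Rightarrow> complex) \<Rightarrow> real \<Rightarrow> real \<Rightarrow> (real \<times> real) set" where
  "superlevel_set g \<sigma> x t \<epsilon> = {(\<eta>, \<kappa>). \<epsilon> < cmod (chirplet_transform g \<sigma> x t \<eta> \<kappa>)}"

definition superlevel_zone ::
    "(real \<Rightarrow> complex) \<Rightarrow> (real \<Rightarrow> real) \<Rightarrow> (real \<Rightarrow> complex) \<Rightarrow> (nat \<Rightarrow> real \<Rightarrow> real) \<Rightarrow>
     real \<Rightarrow> real \<Rightarrow> real \<Rightarrow> real \<Rightarrow> nat \<Rightarrow> (real \<times> real) set" where
  "superlevel_zone g \<sigma> x \<phi> \<rho> \<Delta> t \<epsilon> k =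
     {(\<eta>, \<kappa>) \<in> superlevel_set g \<sigma> x t \<epsilon>. (t, \<eta>, \<kappa>) \<in> zone \<phi> \<rho> \<Delta> k}"

end

theory Submission
  imports Defs
begin

text \<open>
  Near time \<open>t\<close> every component is, up to the error allowed by the slow variation of its amplitude
  and by the third derivative of its phase, the value \<open>x\<^sub>k(t)\<close> times a linear chirp whose
  frequency and chirp rate are \<open>\<phi>\<^sub>k'(t)\<close> and \<open>\<phi>\<^sub>k''(t)\<close>. The transform of such a chirp is
  \<open>x\<^sub>k(t)\<close> times the function \<^const>\<open>window_breve\<close> recentred at the ridge point
  \<open>(\<phi>\<^sub>k'(t), \<phi>\<^sub>k''(t))\<close> and rescaled by \<open>\<sigma>(t)\<close>; here this is called \<open>local_breve\<close>. Integrating the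
  pointwise error against the window produces exactly the moments in \<^const>\<open>model_error\<close>
  (\<open>component_transform_error\<close>). Inside zone \<open>l\<close> the other components are small by the choice of the
  bounding functions, so the transform equals the \<open>l\<close>-th contribution up to \<^const>\<open>Res\<close>
  (\<open>transform_in_zone\<close>).

  At the ridge point itself \<^const>\<open>window_breve\<close> is \<open>1\<close>, hence the modulus of the transform there is at
  least \<open>A\<^sub>l - Res\<^sub>l\<close>, and the maximizer does at least as well. But the modulus at the maximizer is
  also at most \<open>A\<^sub>l\<close> times the modulus of \<open>local_breve\<close> plus \<open>Res\<^sub>l\<close>. Therefore \<open>local_breve\<close> has
  modulus at least \<open>1 - 2 Res\<^sub>l / A\<^sub>l\<close> at the maximizer, and admissibility of the window turns this
  into a bound on the rescaled distance to the ridge point (\<open>admissible_localization\<close>), which is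
  part (a). Since \<^const>\<open>window_breve\<close> is Lipschitz at the origin with constants
  \<open>2 \<pi> I\<^sub>1\<close> and \<open>\<pi> I\<^sub>2\<close> (\<open>window_breve_near_origin\<close>), the bound on the distance gives part (b).
  For a nonnegative window \<^const>\<open>window_breve\<close> never exceeds \<open>1\<close> in modulus, so the upper and lower
  bounds on the modulus at the maximizer match, which is part (c). The trend fits the
  same scheme with the maximizer replaced by its exact ridge point \<open>(0, 0)\<close>.
\<close>

section \<open>Chirp kernels\<close>

lemma cmod_diff_exp_i_le:
  "cmod (exp (\<i> * of_real a) - exp (\<i> * of_real b)) \<le> \<bar>a - b\<bar>"
proof -
  have "exp (\<i> * of_real a) - exp (\<i> * of_real b)
      = exp (\<i> * of_real b) * (exp (\<i> * of_real (a - b)) - 1)"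
    by (simp add: algebra_simps flip: exp_add)
  then have "cmod (exp (\<i> * of_real a) - exp (\<i> * of_real b)) = 2 * \<bar>sin ((a - b) / 2)\<bar>"
    using dist_exp_i_1[of "a - b"] by (simp add: norm_mult)
  also have "\<dots> \<le> \<bar>a - b\<bar>"
    using abs_sin_x_le_abs_x[of "(a - b) / 2"] by simp
  finally show ?thesis .
qed

lemma chirplet_kernel_cis:
  "chirplet_kernel \<eta> \<kappa> \<tau> = exp (\<i> * of_real (- (2 * pi * \<eta> * \<tau> + pi * \<kappa> * \<tau>\<^sup>2)))"
  unfolding chirplet_kernel_def by (simp add: algebra_simps)

lemma norm_chirplet_kernel [simp]: "cmod (chirplet_kernel \<eta> \<kappa> \<tau>) = 1"
  unfolding chirplet_kernel_cis by (rule norm_exp_i_times)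

lemma chirplet_kernel_origin [simp]: "chirplet_kernel 0 0 \<tau> = 1"
  by (simp add: chirplet_kernel_def)

text \<open>
  The two kernel identities below explain the arguments of \<^const>\<open>window_breve\<close> in the main estimates:
  multiplying by a chirp shifts frequency and chirp rate, and dilating time by \<open>r\<close> multiplies them by
  \<open>r\<close> and \<open>r\<^sup>2\<close>.
\<close>

lemma chirplet_kernel_add:
  "chirplet_kernel (a + b) (c + d) \<tau> = chirplet_kernel a c \<tau> * chirplet_kernel b d \<tau>"
  unfolding chirplet_kernel_def by (simp add: algebra_simps flip: exp_add)

lemma chirplet_kernel_dilate:
  "chirplet_kernel \<eta> \<kappa> (r * \<tau>) = chirplet_kernel (r * \<eta>) (r\<^sup>2 * \<kappa>) \<tau>"
  unfolding chirplet_kernel_def by (simp add: power_mult_distrib mult_ac)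

lemma continuous_on_chirplet_kernel [continuous_intros]:
  "continuous_on S (chirplet_kernel \<eta> \<kappa>)"
  unfolding chirplet_kernel_def by (intro continuous_intros)

section \<open>Integrals against a window\<close>

text \<open>
  All analytic estimates are instances of this bound: the factor next to the window grows at most like
  a cubic polynomial, so the integral exists by domination and is controlled by the moments of the
  window. The coefficients \<open>c1\<close> and \<open>c3\<close> serve for the modelling error, \<open>c1\<close> and \<open>c2\<close> for the
  behaviour of \<^const>\<open>window_breve\<close> at the origin, and \<open>c0\<close> for its overall size.
\<close>

lemma window_integral_bound:
  assumes g: "window g" and h: "continuous_on UNIV h"
    and bound: "\<And>s. cmod (h s) \<le> c0 + c1 * \<bar>s\<bar> + c2 * \<bar>s\<bar>^2 + c3 * \<bar>s\<bar>^3"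
  shows "integrable lborel (\<lambda>s. h s * g s)"
    and "cmod (LBINT s. h s * g s)
      \<le> c0 * moment g 0 + c1 * moment g 1 + c2 * moment g 2 + c3 * moment g 3"
proof -
  let ?m = "\<lambda>n s. cmod (g s * of_real (s ^ n))"
  let ?B = "\<lambda>s. c0 * ?m 0 s + c1 * ?m 1 s + c2 * ?m 2 s + c3 * ?m 3 s"
  have m: "integrable lborel (?m n)" if "n \<in> {0, 1, 2, 3}" for n
    using g that unfolding window_def by auto
  have int_B: "integrable lborel ?B"
    by (intro Bochner_Integration.integrable_add integrable_mult_right m) auto
  have le: "cmod (h s * g s) \<le> ?B s" for s
    using mult_right_mono[OF bound[of s], of "cmod (g s)"]
    by (simp add: norm_mult norm_power power_abs algebra_simps)
  have "continuous_on UNIV (\<lambda>s. h s * g s)"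
    using g h by (auto simp: window_def intro!: continuous_intros)
  then have meas: "(\<lambda>s. h s * g s) \<in> borel_measurable lborel"
    using borel_measurable_continuous_onI by auto
  have "norm (h s * g s) \<le> norm (?B s)" for s
    using le[of s] by (metis abs_ge_self order_trans real_norm_def)
  then show int: "integrable lborel (\<lambda>s. h s * g s)"
    using meas by (intro Bochner_Integration.integrable_bound[OF int_B]) auto
  have "cmod (LBINT s. h s * g s) \<le> (LBINT s. ?B s)"
    using integral_norm_bound[of lborel "\<lambda>s. h s * g s"]
      integral_mono[OF integrable_norm[OF int] int_B le] by linarith
  also have "\<dots> = c0 * moment g 0 + c1 * moment g 1 + c2 * moment g 2 + c3 * moment g 3"
    unfolding moment_def
    by (subst Bochner_Integration.integral_add integral_mult_right,
        (intro Bochner_Integration.integrable_add integrable_mult_right m; simp)+)+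
       simp
  finally show "cmod (LBINT s. h s * g s)
      \<le> c0 * moment g 0 + c1 * moment g 1 + c2 * moment g 2 + c3 * moment g 3" .
qed

lemma moment_nonneg [simp]: "0 \<le> moment g n"
  unfolding moment_def by simp

lemma window_breve_origin:
  assumes "window g"
  shows "window_breve g 0 0 = 1"
  using assms by (simp add: window_breve_def window_def)

text \<open>
  Because the window has integral \<open>1\<close>, the difference is the integral of the window against the kernel
  minus \<open>1\<close>, and this factor is at most the modulus of the phase \<open>2 \<pi> \<eta> s + \<pi> \<kappa> s\<^sup>2\<close>.
\<close>

lemma window_breve_near_origin:
  assumes g: "window g"
  shows "cmod (window_breve g \<eta> \<kappa> - 1)
    \<le> 2 * pi * moment g 1 * \<bar>\<eta>\<bar> + pi * moment g 2 * \<bar>\<kappa>\<bar>"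
proof -
  let ?h = "\<lambda>s. chirplet_kernel \<eta> \<kappa> s - 1"
  have "cmod (?h s) \<le> 0 + (2 * pi * \<bar>\<eta>\<bar>) * \<bar>s\<bar> + (pi * \<bar>\<kappa>\<bar>) * \<bar>s\<bar>^2 + 0 * \<bar>s\<bar>^3" for s
  proof -
    have "cmod (?h s) \<le> \<bar>2 * pi * \<eta> * s + pi * \<kappa> * s\<^sup>2\<bar>"
      using cmod_diff_exp_i_le[of "- (2 * pi * \<eta> * s + pi * \<kappa> * s\<^sup>2)" 0]
      by (simp only: chirplet_kernel_cis) (simp del: of_real_add of_real_minus of_real_mult)
    also have "\<dots> \<le> \<bar>2 * pi * \<eta> * s\<bar> + \<bar>pi * \<kappa> * s\<^sup>2\<bar>"
      by (rule abs_triangle_ineq)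
    finally show ?thesis
      by (simp add: abs_mult)
  qed
  note * = window_integral_bound[OF g _ this]
  have "continuous_on UNIV ?h"
    by (intro continuous_intros)
  from *(2)[OF this]
  have "cmod (LBINT s. ?h s * g s) \<le> 2 * pi * moment g 1 * \<bar>\<eta>\<bar> + pi * moment g 2 * \<bar>\<kappa>\<bar>"
    by (simp add: algebra_simps)
  moreover have "integrable lborel (\<lambda>s. chirplet_kernel \<eta> \<kappa> s * g s)"
    by (rule window_integral_bound(1)[OF g continuous_on_chirplet_kernel, of _ _ 1 0 0 0]) simp
  then have "(LBINT s. ?h s * g s) = (LBINT s. chirplet_kernel \<eta> \<kappa> s * g s) - (LBINT s. g s)"
    using g by (simp add: window_def left_diff_distrib)
  then have "(LBINT s. ?h s * g s) = window_breve g \<eta> \<kappa> - 1"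
    using g by (simp add: window_def window_breve_def mult.commute)
  ultimately show ?thesis
    by simp
qed

text \<open>
  A nonnegative window of integral \<open>1\<close> also has \<open>L\<^sub>1\<close> norm \<open>1\<close>, and the kernel is unimodular.
\<close>

lemma window_breve_le_1:
  assumes g: "window g" and nonneg: "\<And>s. g s \<in> \<real>\<^sub>\<ge>\<^sub>0"
  shows "cmod (window_breve g \<eta> \<kappa>) \<le> 1"
proof -
  have norm_g: "of_real (cmod (g s)) = g s" for s
    using nonneg[of s] by (auto elim: nonneg_Reals_cases)
  have "of_real (moment g 0) = (LBINT s. of_real (cmod (g s)) :: complex)"
    by (simp add: moment_def)
  also have "\<dots> = 1"
    using g by (simp add: norm_g window_def)
  finally have "moment g 0 = 1"
    using of_real_eq_1_iff by blast
  then show ?thesis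
    using window_integral_bound(2)[OF g, of "chirplet_kernel \<eta> \<kappa>" 1 0 0 0]
    by (simp add: window_breve_def mult.commute continuous_on_chirplet_kernel)
qed

section \<open>A component is locally a linear chirp\<close>

text \<open>
  The relative Lipschitz condition on amplitudes bounds the increment from \<open>t\<close> by a multiple of its
  length, so it forces continuity everywhere; this supplies the measurability of the integrands.
\<close>

lemma continuous_on_of_relative_lipschitz:
  fixes a :: "real \<Rightarrow> real"
  assumes "\<And>t \<tau>. \<bar>a (t + \<tau>) - a t\<bar> \<le> e * \<bar>\<tau>\<bar> * a t"
  shows "continuous_on UNIV a"
proof -
  have "isCont a t" for t
  proof -
    have "((\<lambda>\<tau>. e * \<bar>\<tau>\<bar> * a t) \<longlongrightarrow> e * \<bar>0\<bar> * a t) (at 0)"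
      by (intro tendsto_intros)
    then have "((\<lambda>\<tau>. a (t + \<tau>) - a t) \<longlongrightarrow> 0) (at 0)"
      by (intro Lim_null_comparison[of "\<lambda>\<tau>. a (t + \<tau>) - a t" "\<lambda>\<tau>. e * \<bar>\<tau>\<bar> * a t"])
         (auto intro!: always_eventually assms)
    then show ?thesis
      unfolding isCont_iff by (simp add: LIM_zero_iff)
  qed
  then show ?thesis
    by (simp add: continuous_on_eq_continuous_at)
qed

lemma C_k_continuous_on:
  assumes "C_k n f" and "0 < n"
  shows "continuous_on UNIV f"
proof -
  have "f differentiable (at t)" for t
    using assms unfolding C_k_def by (metis funpow_0)
  then show ?thesis
    by (simp add: continuous_on_eq_continuous_at differentiable_imp_continuous_within)
qed

lemma second_order_taylor_bound:
  assumes f: "C_k 3 f" and bound: "\<And>s. \<bar>(deriv ^^ 3) f s\<bar> \<le> e"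
  shows "\<bar>f (t + \<tau>) - (f t + deriv f t * \<tau> + (deriv ^^ 2) f t / 2 * \<tau>\<^sup>2)\<bar> \<le> e / 6 * \<bar>\<tau>\<bar>^3"
proof -
  let ?d = "\<lambda>m s. (deriv ^^ m) f (t + s)"
  have "DERIV (?d m) s :> ?d (Suc m) s" if "m < 3" for m s
  proof -
    have "(deriv ^^ m) f differentiable (at (t + s))"
      using f that unfolding C_k_def by blast
    then have "DERIV ((deriv ^^ m) f) (t + s) :> ?d (Suc m) s"
      by (simp add: DERIV_deriv_iff_real_differentiable)
    then show ?thesis
      by (subst (asm) add.commute, subst add.commute) (simp add: DERIV_shift add.commute)
  qed
  then obtain \<xi> where \<xi>: "f (t + \<tau>) = (\<Sum>m<3. ?d m 0 / fact m * \<tau> ^ m) + ?d 3 \<xi> / fact 3 * \<tau> ^ 3"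
    using Maclaurin_bi_le[of ?d "\<lambda>s. f (t + s)" 3 \<tau>] by auto
  have "f (t + \<tau>) - (f t + deriv f t * \<tau> + (deriv ^^ 2) f t / 2 * \<tau>\<^sup>2) = ?d 3 \<xi> / 6 * \<tau> ^ 3"
    unfolding \<xi> by (simp add: numeral_3_eq_3 numeral_2_eq_2 fact_reduce)
  also have "\<bar>\<dots>\<bar> = \<bar>?d 3 \<xi>\<bar> / 6 * \<bar>\<tau>\<bar>^3"
    by (simp add: abs_mult power_abs)
  also have "\<dots> \<le> e / 6 * \<bar>\<tau>\<bar>^3"
    using bound[of "t + \<xi>"] by (intro mult_right_mono) auto
  finally show ?thesis .
qed

text \<open>
  The error splits into the change of the amplitude, taken with the true unimodular phase factor, and
  the change of the phase, taken with the frozen amplitude. The former is the relative Lipschitz bound;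
  the latter is at most \<open>2 \<pi>\<close> times the cubic remainder in the Taylor expansion of the phase.
\<close>

lemma component_linear_chirp_error:
  assumes amp: "\<And>t \<tau>. \<bar>A k (t + \<tau>) - A k t\<bar> \<le> \<epsilon>1 * \<bar>\<tau>\<bar> * A k t" and pos: "0 < A k t"
    and smooth: "C_k 3 (\<phi> k)" and third: "\<And>s. \<bar>(deriv ^^ 3) (\<phi> k) s\<bar> \<le> \<epsilon>3"
  shows "cmod (component A \<phi> k (t + \<tau>)
      - component A \<phi> k t * chirplet_kernel (- deriv (\<phi> k) t) (- (deriv ^^ 2) (\<phi> k) t) \<tau>)
    \<le> A k t * (\<epsilon>1 * \<bar>\<tau>\<bar> + pi / 3 * \<epsilon>3 * \<bar>\<tau>\<bar>^3)"
proof -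
  let ?e = "\<lambda>\<theta>. exp (\<i> * of_real \<theta>)"
  define \<theta> where "\<theta> = 2 * pi * \<phi> k (t + \<tau>)"
  define \<psi> where "\<psi> = 2 * pi * (\<phi> k t + deriv (\<phi> k) t * \<tau> + (deriv ^^ 2) (\<phi> k) t / 2 * \<tau>\<^sup>2)"
  have chirp: "component A \<phi> k t * chirplet_kernel (- deriv (\<phi> k) t) (- (deriv ^^ 2) (\<phi> k) t) \<tau>
      = of_real (A k t) * ?e \<psi>"
    by (simp add: component_def chirplet_kernel_cis \<psi>_def algebra_simps flip: exp_add)
  have "\<theta> - \<psi> = 2 * pi * (\<phi> k (t + \<tau>) - (\<phi> k t + deriv (\<phi> k) t * \<tau> + (deriv ^^ 2) (\<phi> k) t / 2 * \<tau>\<^sup>2))"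
    by (simp add: \<theta>_def \<psi>_def algebra_simps)
  then have "\<bar>\<theta> - \<psi>\<bar> \<le> 2 * pi * (\<epsilon>3 / 6 * \<bar>\<tau>\<bar>^3)"
    using second_order_taylor_bound[OF smooth third, of t \<tau>] by (simp add: abs_mult)
  then have phase: "cmod (?e \<theta> - ?e \<psi>) \<le> pi / 3 * \<epsilon>3 * \<bar>\<tau>\<bar>^3"
    using cmod_diff_exp_i_le[of \<theta> \<psi>] by simp
  have "component A \<phi> k (t + \<tau>) - of_real (A k t) * ?e \<psi>
      = of_real (A k (t + \<tau>) - A k t) * ?e \<theta> + of_real (A k t) * (?e \<theta> - ?e \<psi>)"
    by (simp add: component_def \<theta>_def algebra_simps)
  also have "cmod \<dots> \<le> \<bar>A k (t + \<tau>) - A k t\<bar> + A k t * cmod (?e \<theta> - ?e \<psi>)"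
    using pos by (intro norm_triangle_le) (simp add: norm_mult del: of_real_diff)
  also have "\<dots> \<le> \<epsilon>1 * \<bar>\<tau>\<bar> * A k t + A k t * (pi / 3 * \<epsilon>3 * \<bar>\<tau>\<bar>^3)"
    using amp[of t \<tau>] phase pos by (intro add_mono mult_left_mono) auto
  finally show ?thesis
    unfolding chirp by (simp add: algebra_simps)
qed

section \<open>The transform of a signal\<close>

text \<open>
  The substitution \<open>\<tau> = \<sigma>(t) s\<close> removes the dilation from the window and moves it into the signal and
  the kernel, so that every integral is taken against the same fixed window.
\<close>

lemma chirplet_transform_dilated:
  assumes "0 < \<sigma> t"
  shows "chirplet_transform g \<sigma> x t \<eta> \<kappa>
    = (LBINT s. x (t + \<sigma> t * s) * chirplet_kernel (\<sigma> t * \<eta>) ((\<sigma> t)\<^sup>2 * \<kappa>) s * g s)"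
proof -
  let ?f = "\<lambda>\<tau>. x (t + \<tau>) * of_real (1 / \<sigma> t) * g (\<tau> / \<sigma> t) * chirplet_kernel \<eta> \<kappa> \<tau>"
  have "chirplet_transform g \<sigma> x t \<eta> \<kappa> = \<sigma> t *\<^sub>R (LBINT s. ?f (\<sigma> t * s))"
    unfolding chirplet_transform_def
    using assms lborel_integral_real_affine[of "\<sigma> t" ?f 0] by simp
  also have "\<dots> = (LBINT s. \<sigma> t *\<^sub>R ?f (\<sigma> t * s))"
    by (rule integral_scaleR_right[symmetric])
  also have "\<dots> = (LBINT s. x (t + \<sigma> t * s) * chirplet_kernel (\<sigma> t * \<eta>) ((\<sigma> t)\<^sup>2 * \<kappa>) s * g s)"
    using assms
    by (intro Bochner_Integration.integral_cong) (simp_all add: chirplet_kernel_dilate scaleR_conv_of_real)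
  finally show ?thesis .
qed

text \<open>
  The approximation of the transform by recentred responses concerns all points of the
  frequency-chirp-rate plane, so neither admissibility nor the maximizers belong to this context.
\<close>

locale chirp_signal =
  fixes K :: nat and \<epsilon>1 \<epsilon>3 :: real and A \<phi> :: "nat \<Rightarrow> real \<Rightarrow> real" and x g :: "real \<Rightarrow> complex"
    and \<sigma> :: "real \<Rightarrow> real"
  assumes signal: "signal_decomposition K \<epsilon>1 \<epsilon>3 A \<phi> x"
    and \<epsilon>3_nonneg: "0 \<le> \<epsilon>3"
    and window: "window g"
    and \<sigma>_pos: "0 < \<sigma> s"
begin

lemma signal_sum: "x s = (\<Sum>k\<le>K. component A \<phi> k s)"
  using signal by (simp add: signal_decomposition_def)

lemma amp_pos: "k \<le> K \<Longrightarrow> 0 < A k s"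
  using signal by (simp add: signal_decomposition_def)

lemma amp_lipschitz: "k \<le> K \<Longrightarrow> \<bar>A k (s + \<tau>) - A k s\<bar> \<le> \<epsilon>1 * \<bar>\<tau>\<bar> * A k s"
  using signal by (simp add: signal_decomposition_def)

text \<open>
  The trend has constant phase and therefore satisfies the same smoothness and third-derivative bounds
  as the oscillating components. From here on it needs no separate treatment as a component; its ridge
  point is the origin.
\<close>

lemma trend_phase: "(deriv ^^ m) (\<phi> 0) = (\<lambda>_. 0)"
proof -
  have "\<phi> 0 = (\<lambda>_. 0)"
    using signal by (auto simp: signal_decomposition_def)
  then show ?thesis
    by (induction m) auto
qed

lemma phase_smooth: "k \<le> K \<Longrightarrow> C_k 3 (\<phi> k)"
  using signal trend_phase
  by (cases "k = 0") (auto simp: signal_decomposition_def C_k_def)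

lemma phase_third: "k \<le> K \<Longrightarrow> \<bar>(deriv ^^ 3) (\<phi> k) s\<bar> \<le> \<epsilon>3"
  using signal trend_phase[of 3] \<epsilon>3_nonneg
  by (cases "k = 0") (auto simp: signal_decomposition_def)

lemma continuous_component:
  assumes "k \<le> K"
  shows "continuous_on UNIV (component A \<phi> k)"
proof -
  have "continuous_on UNIV (A k)" "continuous_on UNIV (\<phi> k)"
    using continuous_on_of_relative_lipschitz[OF amp_lipschitz[OF assms]]
      C_k_continuous_on[OF phase_smooth[OF assms]] by auto
  then show ?thesis
    unfolding component_def by (intro continuous_intros) auto
qed

lemma continuous_dilated_component:
  assumes "k \<le> K"
  shows "continuous_on UNIV (\<lambda>s. component A \<phi> k (t + \<sigma> t * s) * chirplet_kernel a b s)"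
proof -
  have "continuous_on UNIV (component A \<phi> k \<circ> (\<lambda>s. t + \<sigma> t * s))"
    by (intro continuous_on_compose continuous_intros)
       (auto intro: continuous_on_subset[OF continuous_component[OF assms]])
  then show ?thesis
    unfolding o_def by (intro continuous_intros)
qed

lemma integrable_component:
  assumes "k \<le> K"
  shows "integrable lborel (\<lambda>s. component A \<phi> k (t + \<sigma> t * s) * chirplet_kernel a b s * g s)"
proof (rule window_integral_bound(1)[OF window continuous_dilated_component[OF assms]])
  fix s
  have "\<bar>A k (t + \<sigma> t * s)\<bar> \<le> A k t + \<epsilon>1 * \<bar>\<sigma> t * s\<bar> * A k t"
    using amp_lipschitz[OF assms, of t "\<sigma> t * s"] amp_pos[OF assms, of t] by linarith
  then show "cmod (component A \<phi> k (t + \<sigma> t * s) * chirplet_kernel a b s)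
      \<le> A k t + (\<epsilon>1 * \<sigma> t * A k t) * \<bar>s\<bar> + 0 * \<bar>s\<bar>^2 + 0 * \<bar>s\<bar>^3"
    using \<sigma>_pos[of t] by (simp add: component_def norm_mult abs_mult mult_ac)
qed

lemmas transform_dilated = chirplet_transform_dilated[of \<sigma>, OF \<sigma>_pos]

lemma chirplet_transform_signal:
  "chirplet_transform g \<sigma> x t \<eta> \<kappa> = (\<Sum>k\<le>K. chirplet_transform g \<sigma> (component A \<phi> k) t \<eta> \<kappa>)"
  by (simp add: transform_dilated signal_sum sum_distrib_right
      Bochner_Integration.integral_sum integrable_component)

text \<open>
  This is the transform at time \<open>t\<close> of the linear chirp that has value \<open>1\<close> at \<open>t\<close> and the same frequency
  and chirp rate there as component \<open>k\<close>.
\<close>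

definition local_breve :: "real \<Rightarrow> nat \<Rightarrow> real \<Rightarrow> real \<Rightarrow> complex" where
  "local_breve t k \<eta> \<kappa> =
     window_breve g (\<sigma> t * (\<eta> - deriv (\<phi> k) t)) ((\<sigma> t)\<^sup>2 * (\<kappa> - (deriv ^^ 2) (\<phi> k) t))"

text \<open>
  After the substitution, both terms are integrals against the window. A unimodular kernel factors out
  of the difference of the integrands, and what remains is the deviation of the component from its
  linear chirp at time \<open>\<sigma>(t) s\<close>; the powers of \<open>\<sigma>(t)\<close> in \<^const>\<open>model_error\<close> come from this argument.
\<close>

lemma component_transform_error:
  assumes k: "k \<le> K"
  shows "cmod (chirplet_transform g \<sigma> (component A \<phi> k) t \<eta> \<kappa>
      - component A \<phi> k t * local_breve t k \<eta> \<kappa>) \<le> A k t * model_error g \<sigma> \<epsilon>1 \<epsilon>3 t"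
proof -
  let ?p = "deriv (\<phi> k) t" and ?q = "(deriv ^^ 2) (\<phi> k) t"
  let ?a = "\<sigma> t * \<eta>" and ?b = "(\<sigma> t)\<^sup>2 * \<kappa>"
  let ?a' = "\<sigma> t * (\<eta> - ?p)" and ?b' = "(\<sigma> t)\<^sup>2 * (\<kappa> - ?q)"
  let ?h = "\<lambda>s. component A \<phi> k (t + \<sigma> t * s) * chirplet_kernel ?a ?b s
    - component A \<phi> k t * chirplet_kernel ?a' ?b' s"
  have factor: "?h s = (component A \<phi> k (t + \<sigma> t * s)
      - component A \<phi> k t * chirplet_kernel (- ?p) (- ?q) (\<sigma> t * s)) * chirplet_kernel ?a ?b s" for s
  proof -
    have "chirplet_kernel ?a' ?b' s = chirplet_kernel (- ?p) (- ?q) (\<sigma> t * s) * chirplet_kernel ?a ?b s"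
      unfolding chirplet_kernel_dilate chirplet_kernel_add[symmetric] by (simp add: algebra_simps)
    then show ?thesis
      by (simp add: algebra_simps)
  qed
  have bound: "cmod (?h s) \<le> 0 + (A k t * \<epsilon>1 * \<sigma> t) * \<bar>s\<bar> + 0 * \<bar>s\<bar>^2
      + (A k t * (pi / 3) * \<epsilon>3 * (\<sigma> t)^3) * \<bar>s\<bar>^3" for s
  proof -
    have "cmod (?h s) \<le> A k t * (\<epsilon>1 * \<bar>\<sigma> t * s\<bar> + pi / 3 * \<epsilon>3 * \<bar>\<sigma> t * s\<bar>^3)"
      unfolding factor norm_mult[of _ "chirplet_kernel ?a ?b s"] norm_chirplet_kernel mult_1_right
      by (rule component_linear_chirp_error)
         (use k amp_lipschitz amp_pos phase_smooth phase_third in auto)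
    also have "\<bar>\<sigma> t * s\<bar> = \<sigma> t * \<bar>s\<bar>"
      using \<sigma>_pos[of t] by (simp add: abs_mult)
    finally show ?thesis
      by (simp add: power_mult_distrib algebra_simps)
  qed
  have "continuous_on UNIV ?h"
    by (intro continuous_on_diff continuous_dilated_component[OF k] continuous_intros)
  from window_integral_bound(2)[OF window this bound]
  have "cmod (LBINT s. ?h s * g s) \<le> A k t * model_error g \<sigma> \<epsilon>1 \<epsilon>3 t"
    by (simp add: model_error_def algebra_simps)
  moreover have "integrable lborel (\<lambda>s. component A \<phi> k t * chirplet_kernel ?a' ?b' s * g s)"
    by (rule window_integral_bound(1)[OF window, of _ "A k t" 0 0 0])
       (intro continuous_intros, simp add: norm_mult component_def amp_pos[OF k] less_imp_le)
  then have "(LBINT s. ?h s * g s)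
      = (LBINT s. component A \<phi> k (t + \<sigma> t * s) * chirplet_kernel ?a ?b s * g s)
        - (LBINT s. component A \<phi> k t * chirplet_kernel ?a' ?b' s * g s)"
    using integrable_component[OF k] by (simp add: left_diff_distrib)
  then have "(LBINT s. ?h s * g s) = chirplet_transform g \<sigma> (component A \<phi> k) t \<eta> \<kappa>
      - component A \<phi> k t * local_breve t k \<eta> \<kappa>"
    by (simp add: transform_dilated local_breve_def window_breve_def mult.assoc mult.commute[of "g _"])
  ultimately show ?thesis
    by simp
qed

lemma transform_error:
  "cmod (chirplet_transform g \<sigma> x t \<eta> \<kappa> - (\<Sum>k\<le>K. component A \<phi> k t * local_breve t k \<eta> \<kappa>))
    \<le> amp_sum K A t * model_error g \<sigma> \<epsilon>1 \<epsilon>3 t"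
  unfolding chirplet_transform_signal amp_sum_def sum_distrib_right sum_subtractf[symmetric]
  by (rule order_trans[OF norm_sum sum_mono]) (use component_transform_error in auto)

text \<open>
  Zone \<open>l\<close> is where the bounding functions control the response to every component other than \<open>l\<close>.
  Moving those components to the error side turns the total modelling error into \<^const>\<open>Res\<close>.
\<close>

lemma transform_in_zone:
  assumes bounding: "bounding_functions K \<phi> g \<sigma> \<rho> \<Delta> \<Upsilon> \<Upsilon>'" and l: "l \<le> K"
    and zone: "(t, \<eta>, \<kappa>) \<in> zone \<phi> \<rho> \<Delta> l"
  shows "cmod (chirplet_transform g \<sigma> x t \<eta> \<kappa> - component A \<phi> l t * local_breve t l \<eta> \<kappa>)
    \<le> Res K A g \<sigma> \<epsilon>1 \<epsilon>3 \<Upsilon>' l t"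
proof -
  let ?c = "\<lambda>k. component A \<phi> k t * local_breve t k \<eta> \<kappa>"
  have "cmod (?c k) \<le> A k t * \<Upsilon>' l k t" if "k \<in> {..K} - {l}" for k
    using that bounding l zone amp_pos[of k t]
    unfolding local_breve_def bounding_functions_def
    by (auto simp: norm_mult component_def)
  then have "cmod (\<Sum>k\<in>{..K} - {l}. ?c k) \<le> (\<Sum>k\<in>{..K} - {l}. A k t * \<Upsilon>' l k t)"
    by (intro order_trans[OF norm_sum sum_mono])
  moreover have "(\<Sum>k\<le>K. ?c k) = ?c l + (\<Sum>k\<in>{..K} - {l}. ?c k)"
    using l by (intro sum.remove) auto
  ultimately show ?thesis
    using transform_error[of t \<eta> \<kappa>]
      norm_triangle_ineq[of "chirplet_transform g \<sigma> x t \<eta> \<kappa> - (\<Sum>k\<le>K. ?c k)" "\<Sum>k\<in>{..K} - {l}. ?c k"]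
    unfolding Res_def by (simp add: algebra_simps)
qed

end

section \<open>Ridge estimates\<close>

lemma le_decreasing_inverse:
  assumes "0 \<le> \<xi>" and "s \<le> \<beta> \<xi>"
  shows "ereal \<xi> \<le> decreasing_inverse \<beta> s"
  unfolding decreasing_inverse_def using assms by (intro SUP_upper) auto

lemma ereal_le_divide_decreasing_inverse:
  assumes r: "0 < r" and "0 \<le> y" and "ereal (r * y) \<le> d"
  shows "ereal y \<le> ereal (1 / r) * d"
proof -
  have "ereal (1 / r) * ereal (r * y) \<le> ereal (1 / r) * d"
    using assms by (intro ereal_mult_left_mono) auto
  then show ?thesis
    using r by simp
qed

text \<open>
  This is the use of admissibility: a value close to \<open>1\<close> can occur only near the origin. The symmetry
  condition allows both arguments to be replaced by their absolute values, where \<open>\<beta>\<close> and \<open>\<gamma>\<close> apply.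
  When \<open>\<beta>\<close> or \<open>\<gamma>\<close> stays above \<open>1 - b\<close>, the corresponding bound is infinite and says nothing.
\<close>

lemma admissible_localization:
  assumes adm: "admissible_window g b0 \<beta> \<gamma>" and b: "0 \<le> b" "b \<le> b0"
    and large: "1 - b \<le> cmod (window_breve g \<eta> \<kappa>)"
  shows "ereal \<bar>\<eta>\<bar> \<le> decreasing_inverse \<beta> (1 - b)"
    and "ereal \<bar>\<kappa>\<bar> \<le> decreasing_inverse \<gamma> (1 - b)"
proof -
  obtain f where f: "\<forall>\<eta> \<kappa>. cmod (window_breve g \<eta> \<kappa>) = f \<bar>\<eta>\<bar> \<bar>\<kappa>\<bar>"
    "\<forall>b\<in>{0..b0}. \<forall>\<eta>\<ge>0. \<forall>\<kappa>\<ge>0. 1 - b \<le> f \<eta> \<kappa> \<longrightarrow> 1 - b \<le> \<beta> \<eta> \<and> 1 - b \<le> \<gamma> \<kappa>"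
    using adm unfolding admissible_window_def by (elim conjE exE) (rule that)
  have "1 - b \<le> f \<bar>\<eta>\<bar> \<bar>\<kappa>\<bar>"
    using f(1) large by simp
  then have "1 - b \<le> \<beta> \<bar>\<eta>\<bar> \<and> 1 - b \<le> \<gamma> \<bar>\<kappa>\<bar>"
    using f(2) b by (metis abs_ge_zero atLeastAtMost_iff)
  then show "ereal \<bar>\<eta>\<bar> \<le> decreasing_inverse \<beta> (1 - b)"
    and "ereal \<bar>\<kappa>\<bar> \<le> decreasing_inverse \<gamma> (1 - b)"
    using le_decreasing_inverse by simp_all
qed


theorem theorem2:
  fixes K :: nat
    and \<epsilon>1 \<epsilon>3 \<rho> \<Delta> b0 t \<epsilon> :: real
    and A \<phi> :: "nat \<Rightarrow> real \<Rightarrow> real"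
    and x g :: "real \<Rightarrow> complex"
    and \<sigma> \<beta> \<gamma> \<Upsilon> :: "real \<Rightarrow> real"
    and \<Upsilon>' :: "nat \<Rightarrow> nat \<Rightarrow> real \<Rightarrow> real"
    and \<eta>h \<kappa>h :: "nat \<Rightarrow> real"
  assumes "1 \<le> K" and "0 < \<epsilon>1" and "0 < \<epsilon>3"
    and "admissible_window g b0 \<beta> \<gamma>"
    and "signal_decomposition K \<epsilon>1 \<epsilon>3 A \<phi> x"
    and "\<And>s. 0 < \<sigma> s"
    and "0 < \<rho>" and "0 < \<Delta>"
    and "\<And>s k l. k \<le> K \<Longrightarrow> l \<le> K \<Longrightarrow> k \<noteq> l \<Longrightarrow>
      2 * \<Delta> \<le> \<bar>deriv (\<phi> k) s - deriv (\<phi> l) s\<bar>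
              + \<rho> * \<bar>(deriv ^^ 2) (\<phi> k) s - (deriv ^^ 2) (\<phi> l) s\<bar>"
    and "bounding_functions K \<phi> g \<sigma> \<rho> \<Delta> \<Upsilon> \<Upsilon>'"
    and "2 * amp_sum K A t * (\<Upsilon> t + model_error g \<sigma> \<epsilon>1 \<epsilon>3 t) \<le> amp_min K A t"
    and "\<And>l. l \<le> K \<Longrightarrow> 2 * Res K A g \<sigma> \<epsilon>1 \<epsilon>3 \<Upsilon>' l t / A l t \<le> b0"
    and "0 < \<epsilon>"
    and "amp_sum K A t * (\<Upsilon> t + model_error g \<sigma> \<epsilon>1 \<epsilon>3 t) \<le> \<epsilon>"
    and "\<epsilon> \<le> amp_min K A t - amp_sum K A t * (\<Upsilon> t + model_error g \<sigma> \<epsilon>1 \<epsilon>3 t)"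
    and "\<eta>h 0 = 0" and "\<kappa>h 0 = 0"
    and "\<And>k. k \<in> {1..K} \<Longrightarrow>
      is_arg_max (\<lambda>(\<eta>, \<kappa>). cmod (chirplet_transform g \<sigma> x t \<eta> \<kappa>))
        (\<lambda>p. p \<in> superlevel_zone g \<sigma> x \<phi> \<rho> \<Delta> t \<epsilon> k) (\<eta>h k, \<kappa>h k)"
  shows "(\<forall>l\<in>{1..K}.
      ereal \<bar>\<eta>h l - deriv (\<phi> l) t\<bar>
        \<le> ereal (1 / \<sigma> t) *
            decreasing_inverse \<beta> (1 - 2 * Res K A g \<sigma> \<epsilon>1 \<epsilon>3 \<Upsilon>' l t / A l t) \<and>
      ereal \<bar>\<kappa>h l - (deriv ^^ 2) (\<phi> l) t\<bar>
        \<le> ereal (1 / (\<sigma> t)\<^sup>2) *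
            decreasing_inverse \<gamma> (1 - 2 * Res K A g \<sigma> \<epsilon>1 \<epsilon>3 \<Upsilon>' l t / A l t))
    \<and> (\<forall>l\<in>{0..K}.
      ereal (cmod (chirplet_transform g \<sigma> x t (\<eta>h l) (\<kappa>h l) - component A \<phi> l t))
        \<le> ereal (Res K A g \<sigma> \<epsilon>1 \<epsilon>3 \<Upsilon>' l t)
          + ereal (2 * pi * moment g 1 * A l t) *
              decreasing_inverse \<beta> (1 - 2 * Res K A g \<sigma> \<epsilon>1 \<epsilon>3 \<Upsilon>' l t / A l t)
          + ereal (pi * moment g 2 * A l t) *
              decreasing_inverse \<gamma> (1 - 2 * Res K A g \<sigma> \<epsilon>1 \<epsilon>3 \<Upsilon>' l t / A l t))
    \<and> ((\<forall>s. g s \<in> \<real>\<^sub>\<ge>\<^sub>0) \<longrightarrow>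
      (\<forall>l\<in>{0..K}.
        \<bar>cmod (chirplet_transform g \<sigma> x t (\<eta>h l) (\<kappa>h l)) - A l t\<bar>
          \<le> Res K A g \<sigma> \<epsilon>1 \<epsilon>3 \<Upsilon>' l t))"
proof -
  note adm = assms(4) and bounding = assms(10) and ridge = assms(18)
  have g: "window g"
    using adm by (simp add: admissible_window_def)
  interpret chirp_signal K \<epsilon>1 \<epsilon>3 A \<phi> x g \<sigma>
    using assms(3,5,6) g by unfold_locales auto
  let ?Q = "\<lambda>\<eta> \<kappa>. cmod (chirplet_transform g \<sigma> x t \<eta> \<kappa>)"
  let ?R = "\<lambda>l. Res K A g \<sigma> \<epsilon>1 \<epsilon>3 \<Upsilon>' l t"
  let ?p = "\<lambda>l. deriv (\<phi> l) t" and ?q = "\<lambda>l. (deriv ^^ 2) (\<phi> l) t"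
  let ?b = "\<lambda>l. 2 * ?R l / A l t"
  let ?B = "\<lambda>l. local_breve t l (\<eta>h l) (\<kappa>h l)"
  have centre_zone: "(t, ?p l, ?q l) \<in> zone \<phi> \<rho> \<Delta> l" for l
    using assms(8) by (simp add: zone_def)
  have centre_breve: "local_breve t l (?p l) (?q l) = 1" for l
    by (simp add: local_breve_def window_breve_origin g)
  have trend: "\<eta>h 0 = ?p 0" "\<kappa>h 0 = ?q 0"
    using trend_phase[of 1] trend_phase[of 2] assms(16,17) by simp_all
  have hat_zone: "(t, \<eta>h l, \<kappa>h l) \<in> zone \<phi> \<rho> \<Delta> l" if "l \<le> K" for l
  proof (cases "l = 0")
    case True
    then show ?thesis
      using centre_zone[of 0] trend by simp
  next
    case False
    then show ?thesis
      using ridge[of l] that by (auto simp: is_arg_max_def superlevel_zone_def)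
  qed
  \<comment> \<open>If the ridge point lies in the superlevel set, it is a competitor of the maximizer. Otherwise its
    value is at most \<open>\<epsilon>\<close>, which the maximizer exceeds.\<close>
  have hat_above_centre: "?Q (?p l) (?q l) \<le> ?Q (\<eta>h l) (\<kappa>h l)" if "l \<le> K" for l
  proof (cases "l = 0")
    case True
    then show ?thesis
      using trend by simp
  next
    case False
    then have "is_arg_max (\<lambda>(\<eta>, \<kappa>). ?Q \<eta> \<kappa>)
        (\<lambda>p. p \<in> superlevel_zone g \<sigma> x \<phi> \<rho> \<Delta> t \<epsilon> l) (\<eta>h l, \<kappa>h l)"
      using ridge[of l] that by simp
    then have "\<epsilon> < ?Q (\<eta>h l) (\<kappa>h l)"
      "(?p l, ?q l) \<in> superlevel_zone g \<sigma> x \<phi> \<rho> \<Delta> t \<epsilon> l \<Longrightarrow> ?Q (?p l) (?q l) \<le> ?Q (\<eta>h l) (\<kappa>h l)"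
      by (auto simp: is_arg_max_linorder superlevel_zone_def superlevel_set_def)
    then show ?thesis
      using centre_zone[of l]
      by (cases "\<epsilon> < ?Q (?p l) (?q l)") (auto simp: superlevel_zone_def superlevel_set_def)
  qed
  have near: "cmod (chirplet_transform g \<sigma> x t (\<eta>h l) (\<kappa>h l) - component A \<phi> l t * ?B l) \<le> ?R l"
    if "l \<le> K" for l
    by (rule transform_in_zone[OF bounding that hat_zone[OF that]])
  have norm_component: "cmod (component A \<phi> l t) = A l t" if "l \<le> K" for l
    using amp_pos[OF that, of t] by (simp add: component_def norm_mult)
  have lower: "A l t - ?R l \<le> ?Q (\<eta>h l) (\<kappa>h l)" if "l \<le> K" for l
  proof -
    have "cmod (chirplet_transform g \<sigma> x t (?p l) (?q l) - component A \<phi> l t) \<le> ?R l"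
      using transform_in_zone[OF bounding that centre_zone] by (simp add: centre_breve)
    then show ?thesis
      using hat_above_centre[OF that] norm_component[OF that]
        norm_triangle_ineq2[of "component A \<phi> l t" "chirplet_transform g \<sigma> x t (?p l) (?q l)"]
      by (simp add: norm_minus_commute)
  qed
  have upper: "?Q (\<eta>h l) (\<kappa>h l) \<le> A l t * cmod (?B l) + ?R l" if "l \<le> K" for l
    using near[OF that] norm_component[OF that]
      norm_triangle_ineq2[of "chirplet_transform g \<sigma> x t (\<eta>h l) (\<kappa>h l)" "component A \<phi> l t * ?B l"]
    by (simp add: norm_mult)
  \<comment> \<open>Comparing \<open>lower\<close> with \<open>upper\<close> forces the response to be nearly \<open>1\<close> in modulus at the maximizer.\<close>
  have localized:
    "ereal (\<sigma> t * \<bar>\<eta>h l - ?p l\<bar>) \<le> decreasing_inverse \<beta> (1 - ?b l)"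
    "ereal ((\<sigma> t)\<^sup>2 * \<bar>\<kappa>h l - ?q l\<bar>) \<le> decreasing_inverse \<gamma> (1 - ?b l)" if l: "l \<le> K" for l
  proof -
    have "A l t - 2 * ?R l \<le> A l t * cmod (?B l)"
      using lower[OF l] upper[OF l] by linarith
    then have large: "1 - ?b l \<le> cmod (?B l)"
      using amp_pos[OF l, of t] by (simp add: field_simps)
    have "0 \<le> ?R l"
      using near[OF l] norm_ge_zero order_trans by blast
    then have "0 \<le> ?b l"
      using amp_pos[OF l, of t] by simp
    from admissible_localization[OF adm this assms(12)[OF l] large[unfolded local_breve_def]]
    show "ereal (\<sigma> t * \<bar>\<eta>h l - ?p l\<bar>) \<le> decreasing_inverse \<beta> (1 - ?b l)"
      "ereal ((\<sigma> t)\<^sup>2 * \<bar>\<kappa>h l - ?q l\<bar>) \<le> decreasing_inverse \<gamma> (1 - ?b l)"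
      using \<sigma>_pos[of t] by (simp_all add: abs_mult)
  qed
  have recovery: "ereal (cmod (chirplet_transform g \<sigma> x t (\<eta>h l) (\<kappa>h l) - component A \<phi> l t))
      \<le> ereal (?R l) + ereal (2 * pi * moment g 1 * A l t) * decreasing_inverse \<beta> (1 - ?b l)
        + ereal (pi * moment g 2 * A l t) * decreasing_inverse \<gamma> (1 - ?b l)" if l: "l \<le> K" for l
  proof -
    let ?c1 = "2 * pi * moment g 1 * A l t" and ?c2 = "pi * moment g 2 * A l t"
    let ?\<eta> = "\<sigma> t * \<bar>\<eta>h l - ?p l\<bar>" and ?\<kappa> = "(\<sigma> t)\<^sup>2 * \<bar>\<kappa>h l - ?q l\<bar>"
    have "cmod (?B l - 1) \<le> 2 * pi * moment g 1 * ?\<eta> + pi * moment g 2 * ?\<kappa>"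
      using window_breve_near_origin[OF g, of "\<sigma> t * (\<eta>h l - ?p l)" "(\<sigma> t)\<^sup>2 * (\<kappa>h l - ?q l)"]
        \<sigma>_pos[of t]
      by (simp add: local_breve_def abs_mult)
    then have "A l t * cmod (?B l - 1) \<le> ?c1 * ?\<eta> + ?c2 * ?\<kappa>"
      by (drule_tac mult_left_mono[OF _ less_imp_le[OF amp_pos[OF l, of t]]]) (simp add: algebra_simps)
    moreover have "cmod (component A \<phi> l t * ?B l - component A \<phi> l t) = A l t * cmod (?B l - 1)"
      using norm_component[OF l] norm_mult[of "component A \<phi> l t" "?B l - 1"]
      by (simp add: right_diff_distrib)
    ultimately have "cmod (chirplet_transform g \<sigma> x t (\<eta>h l) (\<kappa>h l) - component A \<phi> l t)
        \<le> ?R l + ?c1 * ?\<eta> + ?c2 * ?\<kappa>"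
      using norm_triangle_ineq[of "chirplet_transform g \<sigma> x t (\<eta>h l) (\<kappa>h l) - component A \<phi> l t * ?B l"
          "component A \<phi> l t * ?B l - component A \<phi> l t"] near[OF l]
      by simp
    \<comment> \<open>Only now pass to the extended reals, where the inverses may be infinite; the coefficients are
      nonnegative, so monotonicity also holds when a coefficient is \<open>0\<close> and the inverse is \<open>\<infinity>\<close>.\<close>
    then have "ereal (cmod (chirplet_transform g \<sigma> x t (\<eta>h l) (\<kappa>h l) - component A \<phi> l t))
        \<le> ereal (?R l) + ereal ?c1 * ereal ?\<eta> + ereal ?c2 * ereal ?\<kappa>"
      by simp
    also have "\<dots> \<le> ereal (?R l) + ereal ?c1 * decreasing_inverse \<beta> (1 - ?b l)
        + ereal ?c2 * decreasing_inverse \<gamma> (1 - ?b l)"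
      using localized[OF l] amp_pos[OF l, of t]
      by (intro add_mono ereal_mult_left_mono order_refl) auto
    finally show ?thesis .
  qed
  have amplitude: "\<bar>?Q (\<eta>h l) (\<kappa>h l) - A l t\<bar> \<le> ?R l"
    if l: "l \<le> K" and nonneg: "\<forall>s. g s \<in> \<real>\<^sub>\<ge>\<^sub>0" for l
  proof -
    have "cmod (?B l) \<le> 1"
      unfolding local_breve_def using nonneg by (intro window_breve_le_1[OF g]) auto
    then have "A l t * cmod (?B l) \<le> A l t"
      using amp_pos[OF l, of t] by (simp add: mult_left_le)
    then show ?thesis
      using lower[OF l] upper[OF l] by linarith
  qed
  show ?thesis
    using localized recovery amplitude \<sigma>_pos[of t]
    by (auto intro!: ereal_le_divide_decreasing_inverse)
qed

end
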